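(* A finite hoop is irreducible if and only if it is simple.
   Context: A hoop is an algebra $\mathbf A=(A;\cdot,\rightarrow,1)$ of type $\langle 2,2,0\rangle$ such that $(A;\cdot,1)$ is a commutative monoid and the identities $x\rightarrow x=1$, $(x\cdot y)\rightarrow z=x\rightarrow(y\rightarrow z)$ and $x\cdot(x\rightarrow y)=y\cdot(y\rightarrow x)$ hold. The order is $x\leq y$ iff $x\rightarrow y=1$; infima exist and $x\wedge y=x\cdot(x\rightarrow y)$. A map $f\colon C\to B$ between hoops is a product morphism if $f(1)=1$ and $f(x)\cdot f(y)=f(x\cdot y)=f(x)\wedge f(y)=f(x\wedge y)$ for all $x,y\in C$. For such $f$, the $f$-product $\mathbf B\ltimes_f\mathbf C$ is the hoop with universe $\{(b,x)\in B\times C\mid b\leq f(x)\}$, constant $(1,1)$ and operations $(a,x)\cdot(b,y)=(a\cdot b,\,x\cdot y)$ and $(a,x)\rightarrow(b,y)=(f(x\rightarrow y)\wedge(a\rightarrow b),\,x\rightarrow y)$. A hoop $\mathbf A$ is irreducible if whenever $\mathbf A\cong\mathbf B\ltimes_f\mathbf C$ for some hoops $\mathbf B,\mathbf C$ and product morphism $f\colon\mathbf C\to\mathbf B$, one of $\mathbf B,\mathbf C$ is the trivial (one-element) hoop. Simple means simple as an algebra (congruences of a hoop correspond to its filters, i.e. nonempty upward closed subsets closed under $\cdot$). *)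

theory Defs
  imports "HOL-Algebra.Group"
begin

record 'a hoop_alg = "'a monoid" +
  himp :: "'a \<Rightarrow> 'a \<Rightarrow> 'a"  (infixr \<open>\<leadsto>\<index>\<close> 65)

locale hoop = comm_monoid A for A (structure) +
  assumes imp_closed: "\<lbrakk>x \<in> carrier A; y \<in> carrier A\<rbrakk> \<Longrightarrow> x \<leadsto> y \<in> carrier A"
    and imp_refl: "x \<in> carrier A \<Longrightarrow> x \<leadsto> x = \<one>"
    and imp_curry: "\<lbrakk>x \<in> carrier A; y \<in> carrier A; z \<in> carrier A\<rbrakk>
      \<Longrightarrow> (x \<otimes> y) \<leadsto> z = x \<leadsto> (y \<leadsto> z)"
    and divisible: "\<lbrakk>x \<in> carrier A; y \<in> carrier A\<rbrakk>
      \<Longrightarrow> x \<otimes> (x \<leadsto> y) = y \<otimes> (y \<leadsto> x)"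

definition hoop_le :: "('a, 'm) hoop_alg_scheme \<Rightarrow> 'a \<Rightarrow> 'a \<Rightarrow> bool"
  where "hoop_le A x y \<longleftrightarrow> x \<leadsto>\<^bsub>A\<^esub> y = \<one>\<^bsub>A\<^esub>"

text \<open>The lemmas \<open>hoop_meet_le1\<close>, \<open>hoop_meet_le2\<close> and \<open>hoop_meet_greatest\<close> below show that
  this term is the infimum with respect to \<^const>\<open>hoop_le\<close>.\<close>

definition hoop_meet :: "('a, 'm) hoop_alg_scheme \<Rightarrow> 'a \<Rightarrow> 'a \<Rightarrow> 'a"
  where "hoop_meet A x y = x \<otimes>\<^bsub>A\<^esub> (x \<leadsto>\<^bsub>A\<^esub> y)"

definition product_morphism ::
    "('c, 'm) hoop_alg_scheme \<Rightarrow> ('b, 'n) hoop_alg_scheme \<Rightarrow> ('c \<Rightarrow> 'b) \<Rightarrow> bool"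
  where "product_morphism C B f \<longleftrightarrow>
    f \<in> carrier C \<rightarrow> carrier B \<and> f \<one>\<^bsub>C\<^esub> = \<one>\<^bsub>B\<^esub> \<and>
    (\<forall>x \<in> carrier C. \<forall>y \<in> carrier C.
      f x \<otimes>\<^bsub>B\<^esub> f y = f (x \<otimes>\<^bsub>C\<^esub> y) \<and>
      f (x \<otimes>\<^bsub>C\<^esub> y) = hoop_meet B (f x) (f y) \<and>
      hoop_meet B (f x) (f y) = f (hoop_meet C x y))"

definition f_product ::
    "('b, 'n) hoop_alg_scheme \<Rightarrow> ('c \<Rightarrow> 'b) \<Rightarrow> ('c, 'm) hoop_alg_scheme \<Rightarrow> ('b \<times> 'c) hoop_alg"
  where "f_product B f C =
    \<lparr>carrier = {(b, x). b \<in> carrier B \<and> x \<in> carrier C \<and> hoop_le B b (f x)},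
     mult = (\<lambda>(a, x) (b, y). (a \<otimes>\<^bsub>B\<^esub> b, x \<otimes>\<^bsub>C\<^esub> y)),
     one = (\<one>\<^bsub>B\<^esub>, \<one>\<^bsub>C\<^esub>),
     himp = (\<lambda>(a, x) (b, y). (hoop_meet B (f (x \<leadsto>\<^bsub>C\<^esub> y)) (a \<leadsto>\<^bsub>B\<^esub> b), x \<leadsto>\<^bsub>C\<^esub> y))\<rparr>"

definition hoop_iso ::
    "('a, 'm) hoop_alg_scheme \<Rightarrow> ('b, 'n) hoop_alg_scheme \<Rightarrow> ('a \<Rightarrow> 'b) set"
  where "hoop_iso A B = {h \<in> iso A B. h \<one>\<^bsub>A\<^esub> = \<one>\<^bsub>B\<^esub> \<and>
    (\<forall>x \<in> carrier A. \<forall>y \<in> carrier A. h (x \<leadsto>\<^bsub>A\<^esub> y) = h x \<leadsto>\<^bsub>B\<^esub> h y)}"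

definition trivial_hoop :: "('a, 'm) hoop_alg_scheme \<Rightarrow> bool"
  where "trivial_hoop A \<longleftrightarrow> carrier A = {\<one>\<^bsub>A\<^esub>}"

text \<open>The factors range over hoops whose elements have the same type as those of \<open>A\<close>, because a
  definition cannot quantify over types. This is no restriction: both factors embed into their
  product, and \<open>irreducible_hoopD\<close> below gives the property for factors of arbitrary types.
  The one-element hoop is irreducible.\<close>

definition irreducible_hoop :: "'a hoop_alg \<Rightarrow> bool"
  where "irreducible_hoop A \<longleftrightarrow>
    (\<forall>(B :: 'a hoop_alg) (C :: 'a hoop_alg) f.
      hoop B \<longrightarrow> hoop C \<longrightarrow> product_morphism C B f \<longrightarrow> hoop_iso A (f_product B f C) \<noteq> {} \<longrightarrow>
      trivial_hoop B \<or> trivial_hoop C)"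

definition hoop_congruence :: "('a, 'm) hoop_alg_scheme \<Rightarrow> ('a \<times> 'a) set \<Rightarrow> bool"
  where "hoop_congruence A \<theta> \<longleftrightarrow> equiv (carrier A) \<theta> \<and>
    (\<forall>(x, x') \<in> \<theta>. \<forall>(y, y') \<in> \<theta>.
      (x \<otimes>\<^bsub>A\<^esub> y, x' \<otimes>\<^bsub>A\<^esub> y') \<in> \<theta> \<and> (x \<leadsto>\<^bsub>A\<^esub> y, x' \<leadsto>\<^bsub>A\<^esub> y') \<in> \<theta>)"

text \<open>The two congruences below are not required to be distinct: the one-element hoop is simple,
  in accordance with its being irreducible.\<close>

definition simple_hoop :: "('a, 'm) hoop_alg_scheme \<Rightarrow> bool"
  where "simple_hoop A \<longleftrightarrow>
    {\<theta>. hoop_congruence A \<theta>} = {Id_on (carrier A), carrier A \<times> carrier A}"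


context hoop
begin

lemma le_antisym:
  assumes "x \<in> carrier A" "y \<in> carrier A" "hoop_le A x y" "hoop_le A y x"
  shows "x = y"
  using divisible[of x y] assms by (simp add: hoop_le_def)

lemma one_imp:
  assumes x: "x \<in> carrier A"
  shows "\<one> \<leadsto> x = x"
proof (rule le_antisym)
  have c: "\<one> \<leadsto> x \<in> carrier A" using x imp_closed by simp
  show "hoop_le A x (\<one> \<leadsto> x)"
    using imp_curry[of x \<one> x] x imp_refl by (simp add: hoop_le_def)
  show "hoop_le A (\<one> \<leadsto> x) x"
    using imp_curry[of "\<one> \<leadsto> x" \<one> x] x c imp_refl[OF c] by (simp add: hoop_le_def)
qed (use x imp_closed in auto)

lemma imp_one:
  assumes x: "x \<in> carrier A"
  shows "x \<leadsto> \<one> = \<one>"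
proof -
  have c: "x \<leadsto> \<one> \<in> carrier A" using x imp_closed by simp
  have "x \<otimes> (x \<leadsto> \<one>) = x"
    using divisible[of x \<one>] x c one_imp by simp
  then have "x \<leadsto> \<one> = ((x \<leadsto> \<one>) \<otimes> x) \<leadsto> \<one>"
    using x c by (simp add: m_comm)
  also have "\<dots> = \<one>"
    using imp_curry[OF c x one_closed] imp_refl[OF c] by simp
  finally show ?thesis .
qed

lemma le_refl: "x \<in> carrier A \<Longrightarrow> hoop_le A x x"
  by (simp add: hoop_le_def imp_refl)

lemma le_one: "x \<in> carrier A \<Longrightarrow> hoop_le A x \<one>"
  by (simp add: hoop_le_def imp_one)

lemma residuation:
  "\<lbrakk>x \<in> carrier A; y \<in> carrier A; z \<in> carrier A\<rbrakk>
    \<Longrightarrow> hoop_le A (x \<otimes> y) z \<longleftrightarrow> hoop_le A x (y \<leadsto> z)"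
  by (simp add: hoop_le_def imp_curry)

lemma le_trans:
  assumes c: "x \<in> carrier A" "y \<in> carrier A" "z \<in> carrier A"
    and "hoop_le A x y" "hoop_le A y z"
  shows "hoop_le A x z"
proof -
  have cl: "y \<leadsto> x \<in> carrier A" using c imp_closed by simp
  have "x = (y \<leadsto> x) \<otimes> y"
    using divisible[of x y] assms cl by (simp add: hoop_le_def m_comm)
  then have "x \<leadsto> z = (y \<leadsto> x) \<leadsto> (y \<leadsto> z)"
    using imp_curry[OF cl c(2,3)] by simp
  then show ?thesis using assms cl imp_one by (simp add: hoop_le_def)
qed

lemma meet_closed:
  "\<lbrakk>x \<in> carrier A; y \<in> carrier A\<rbrakk> \<Longrightarrow> hoop_meet A x y \<in> carrier A"
  by (simp add: hoop_meet_def imp_closed)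

lemma hoop_meet_le2:
  assumes "x \<in> carrier A" "y \<in> carrier A"
  shows "hoop_le A (hoop_meet A x y) y"
proof -
  have "hoop_meet A x y = (x \<leadsto> y) \<otimes> x"
    using assms imp_closed m_comm by (simp add: hoop_meet_def)
  then show ?thesis using residuation le_refl assms imp_closed by simp
qed

lemma hoop_meet_le1:
  assumes "x \<in> carrier A" "y \<in> carrier A"
  shows "hoop_le A (hoop_meet A x y) x"
  using hoop_meet_le2[of y x] divisible[of x y] assms by (simp add: hoop_meet_def)

lemma hoop_meet_greatest:
  assumes c: "x \<in> carrier A" "y \<in> carrier A" "z \<in> carrier A"
    and zx: "hoop_le A z x" and zy: "hoop_le A z y"
  shows "hoop_le A z (hoop_meet A x y)"
proof -
  have cl: "x \<leadsto> z \<in> carrier A" "x \<leadsto> y \<in> carrier A" using c imp_closed by auto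
  have z: "z = (x \<leadsto> z) \<otimes> x"
    using divisible[of x z] zx c cl by (simp add: hoop_le_def m_comm)
  have 1: "hoop_le A (x \<leadsto> z) (x \<leadsto> y)"
    using z zy residuation[of "x \<leadsto> z" x y] c cl by simp
  have 2: "hoop_le A (x \<leadsto> y) (x \<leadsto> (hoop_meet A x y))"
    using residuation[of "x \<leadsto> y" x "hoop_meet A x y"] c cl le_refl meet_closed[of x y]
    by (simp add: hoop_meet_def m_comm)
  have "hoop_le A (x \<leadsto> z) (x \<leadsto> (hoop_meet A x y))"
    using le_trans[OF _ _ _ 1 2] c cl meet_closed imp_closed by simp
  then have "hoop_le A ((x \<leadsto> z) \<otimes> x) (hoop_meet A x y)"
    using residuation c cl meet_closed by simp
  then show ?thesis using z by simp
qed

end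


definition hoop_transport :: "('b \<Rightarrow> 'a) \<Rightarrow> ('b, 'm) hoop_alg_scheme \<Rightarrow> 'a hoop_alg"
  where "hoop_transport g B = (let k = inv_into (carrier B) g in
    \<lparr>carrier = g ` carrier B,
     mult = (\<lambda>x y. g (k x \<otimes>\<^bsub>B\<^esub> k y)),
     one = g \<one>\<^bsub>B\<^esub>,
     himp = (\<lambda>x y. g (k x \<leadsto>\<^bsub>B\<^esub> k y))\<rparr>)"

lemma carrier_transport [simp]: "carrier (hoop_transport g B) = g ` carrier B"
  and one_transport [simp]: "\<one>\<^bsub>hoop_transport g B\<^esub> = g \<one>\<^bsub>B\<^esub>"
  by (simp_all add: hoop_transport_def Let_def)

lemma mult_transport [simp]:
  "\<lbrakk>inj_on g (carrier B); x \<in> carrier B; y \<in> carrier B\<rbrakk>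
    \<Longrightarrow> g x \<otimes>\<^bsub>hoop_transport g B\<^esub> g y = g (x \<otimes>\<^bsub>B\<^esub> y)"
  by (simp add: hoop_transport_def Let_def)

lemma imp_transport [simp]:
  "\<lbrakk>inj_on g (carrier B); x \<in> carrier B; y \<in> carrier B\<rbrakk>
    \<Longrightarrow> g x \<leadsto>\<^bsub>hoop_transport g B\<^esub> g y = g (x \<leadsto>\<^bsub>B\<^esub> y)"
  by (simp add: hoop_transport_def Let_def)

lemma hoop_transport:
  assumes "hoop B" and g: "inj_on g (carrier B)"
  shows "hoop (hoop_transport g B)"
proof -
  interpret B: hoop B by fact
  note [simp] = g B.imp_closed
  show ?thesis
  proof unfold_locales
    show "\<And>x y. x \<in> carrier (hoop_transport g B) \<Longrightarrow> y \<in> carrier (hoop_transport g B) \<Longrightarrow>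
        x \<otimes>\<^bsub>hoop_transport g B\<^esub> (x \<leadsto>\<^bsub>hoop_transport g B\<^esub> y) =
        y \<otimes>\<^bsub>hoop_transport g B\<^esub> (y \<leadsto>\<^bsub>hoop_transport g B\<^esub> x)"
      by (auto simp: B.divisible)
  qed (auto simp: B.m_ac B.imp_refl B.imp_curry)
qed

lemma meet_transport:
  assumes "hoop B" "inj_on g (carrier B)" "x \<in> carrier B" "y \<in> carrier B"
  shows "hoop_meet (hoop_transport g B) (g x) (g y) = g (hoop_meet B x y)"
  using assms by (simp add: hoop_meet_def hoop.imp_closed)

lemma le_transport:
  assumes "hoop B" and g: "inj_on g (carrier B)" and c: "x \<in> carrier B" "y \<in> carrier B"
  shows "hoop_le (hoop_transport g B) (g x) (g y) \<longleftrightarrow> hoop_le B x y"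
proof -
  interpret B: hoop B by fact
  show ?thesis
    using c B.imp_closed by (simp add: hoop_le_def g inj_on_eq_iff[OF g])
qed

lemma trivial_transport:
  assumes "hoop B" and g: "inj_on g (carrier B)" and t: "trivial_hoop (hoop_transport g B)"
  shows "trivial_hoop B"
proof -
  interpret B: hoop B by fact
  have "g ` carrier B = {g \<one>\<^bsub>B\<^esub>}" using t by (simp add: trivial_hoop_def)
  then have "x = \<one>\<^bsub>B\<^esub>" if "x \<in> carrier B" for x
    using that inj_onD[OF g, of x "\<one>\<^bsub>B\<^esub>"] by blast
  then show ?thesis by (auto simp: trivial_hoop_def)
qed

lemma irreducible_hoopD:
  fixes A :: "'a hoop_alg" and B :: "('b, 'm) hoop_alg_scheme" and C :: "('c, 'n) hoop_alg_scheme"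
  assumes irr: "irreducible_hoop A"
    and B: "hoop B" and C: "hoop C" and f: "product_morphism C B f"
    and ne: "hoop_iso A (f_product B f C) \<noteq> {}"
  shows "trivial_hoop B \<or> trivial_hoop C"
proof -
  interpret B: hoop B by fact
  interpret C: hoop C by fact
  let ?P = "f_product B f C"
  obtain h where h: "h \<in> hoop_iso A ?P" using ne by auto
  have bij: "bij_betw h (carrier A) (carrier ?P)" using h by (auto simp: hoop_iso_def iso_def)
  have fC: "f x \<in> carrier B" if "x \<in> carrier C" for x
    using f that by (auto simp: product_morphism_def)
  have f1: "f \<one>\<^bsub>C\<^esub> = \<one>\<^bsub>B\<^esub>" using f by (simp add: product_morphism_def)
  define k where "k = inv_into (carrier A) h"
  have k: "inj_on k (carrier ?P)"
    using bij_betw_inv_into[OF bij] by (simp add: k_def bij_betw_def)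
  define u where "u = (\<lambda>b. k (b, \<one>\<^bsub>C\<^esub>))"
  define v where "v = (\<lambda>x. k (f x, x))"
  have u: "inj_on u (carrier B)"
  proof (rule inj_onI)
    fix a b assume "a \<in> carrier B" "b \<in> carrier B" "u a = u b"
    then show "a = b"
      using inj_onD[OF k, of "(a, \<one>\<^bsub>C\<^esub>)" "(b, \<one>\<^bsub>C\<^esub>)"]
      by (simp add: u_def f_product_def f1 B.le_one)
  qed
  have v: "inj_on v (carrier C)"
  proof (rule inj_onI)
    fix x y assume "x \<in> carrier C" "y \<in> carrier C" "v x = v y"
    then show "x = y"
      using inj_onD[OF k, of "(f x, x)" "(f y, y)"]
      by (simp add: v_def f_product_def fC B.le_refl)
  qed
  define B' where "B' = hoop_transport u B"
  define C' where "C' = hoop_transport v C"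
  define f' where "f' = (\<lambda>z. u (f (inv_into (carrier C) v z)))"
  have f'v: "f' (v x) = u (f x)" if "x \<in> carrier C" for x
    using that v by (simp add: f'_def)
  have hB': "hoop B'" and hC': "hoop C'"
    using hoop_transport B C u v by (auto simp: B'_def C'_def)
  have f': "product_morphism C' B' f'"
    unfolding product_morphism_def
  proof (intro conjI ballI)
    show "f' \<in> carrier C' \<rightarrow> carrier B'"
      by (auto simp: C'_def B'_def f'v fC)
    show "f' \<one>\<^bsub>C'\<^esub> = \<one>\<^bsub>B'\<^esub>"
      by (simp add: C'_def B'_def f'v f1)
    fix z w assume "z \<in> carrier C'" "w \<in> carrier C'"
    then obtain x y where xy: "x \<in> carrier C" "y \<in> carrier C" "z = v x" "w = v y"
      by (auto simp: C'_def)
    have e: "f x \<otimes>\<^bsub>B\<^esub> f y = f (x \<otimes>\<^bsub>C\<^esub> y)"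
      "f (x \<otimes>\<^bsub>C\<^esub> y) = hoop_meet B (f x) (f y)"
      "hoop_meet B (f x) (f y) = f (hoop_meet C x y)"
      using f xy by (auto simp: product_morphism_def)
    show "f' z \<otimes>\<^bsub>B'\<^esub> f' w = f' (z \<otimes>\<^bsub>C'\<^esub> w)"
      using xy e by (simp add: f'v B'_def C'_def u v fC)
    show "f' (z \<otimes>\<^bsub>C'\<^esub> w) = hoop_meet B' (f' z) (f' w)"
      using xy e by (simp add: f'v B'_def C'_def u v fC meet_transport B)
    show "hoop_meet B' (f' z) (f' w) = f' (hoop_meet C' z w)"
      using xy e
      by (simp add: f'v B'_def C'_def u v fC meet_transport B C C.meet_closed)
  qed
  let ?P' = "f_product B' f' C'"
  define m where "m = (\<lambda>(b, x). (u b, v x))"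
  have carP: "(b, x) \<in> carrier ?P \<longleftrightarrow> b \<in> carrier B \<and> x \<in> carrier C \<and> hoop_le B b (f x)" for b x
    by (simp add: f_product_def)
  have carP': "(z, w) \<in> carrier ?P' \<longleftrightarrow> z \<in> carrier B' \<and> w \<in> carrier C' \<and> hoop_le B' z (f' w)"
    for z w by (simp add: f_product_def)
  have leP': "hoop_le B' (u b) (f' (v x)) \<longleftrightarrow> hoop_le B b (f x)"
    if "b \<in> carrier B" "x \<in> carrier C" for b x
    using that by (simp add: B'_def le_transport[OF B u] f'v fC)
  have mbij: "bij_betw m (carrier ?P) (carrier ?P')"
    unfolding bij_betw_def
  proof
    show "inj_on m (carrier ?P)"
      using u v by (auto simp: inj_on_def m_def carP)
    show "m ` carrier ?P = carrier ?P'"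
    proof (intro equalityI subsetI)
      fix p assume "p \<in> m ` carrier ?P"
      then obtain b x where bx: "p = (u b, v x)" "(b, x) \<in> carrier ?P"
        by (auto simp: m_def)
      show "p \<in> carrier ?P'"
        using bx leP'[of b x] by (simp add: carP carP') (simp add: B'_def C'_def)
    next
      fix p assume p: "p \<in> carrier ?P'"
      obtain z w where zw: "p = (z, w)" by (cases p)
      then have "z \<in> carrier B'" "w \<in> carrier C'" using p carP' by auto
      then obtain b x where bx: "z = u b" "w = v x" "b \<in> carrier B" "x \<in> carrier C"
        by (auto simp: B'_def C'_def)
      then have "(b, x) \<in> carrier ?P"
        using p zw leP'[of b x] by (simp add: carP carP')
      then show "p \<in> m ` carrier ?P"
        using bx zw by (force simp: m_def)
    qed
  qed
  have mmult: "m (p \<otimes>\<^bsub>?P\<^esub> q) = m p \<otimes>\<^bsub>?P'\<^esub> m q"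
    and mimp: "m (p \<leadsto>\<^bsub>?P\<^esub> q) = m p \<leadsto>\<^bsub>?P'\<^esub> m q"
    if pq: "p \<in> carrier ?P" "q \<in> carrier ?P" for p q
  proof -
    obtain a x b y where e: "p = (a, x)" "q = (b, y)" by (cases p, cases q)
    have c: "a \<in> carrier B" "x \<in> carrier C" "b \<in> carrier B" "y \<in> carrier C"
      using pq by (auto simp: e carP)
    show "m (p \<otimes>\<^bsub>?P\<^esub> q) = m p \<otimes>\<^bsub>?P'\<^esub> m q"
      using c by (simp add: e m_def f_product_def B'_def C'_def u v)
    have "hoop_meet B' (f' (v x \<leadsto>\<^bsub>C'\<^esub> v y)) (u a \<leadsto>\<^bsub>B'\<^esub> u b)
        = u (hoop_meet B (f (x \<leadsto>\<^bsub>C\<^esub> y)) (a \<leadsto>\<^bsub>B\<^esub> b))"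
      using c by (simp add: B'_def C'_def u v f'v meet_transport B fC B.imp_closed C.imp_closed)
    moreover have "v x \<leadsto>\<^bsub>C'\<^esub> v y = v (x \<leadsto>\<^bsub>C\<^esub> y)"
      using c by (simp add: C'_def v)
    ultimately show "m (p \<leadsto>\<^bsub>?P\<^esub> q) = m p \<leadsto>\<^bsub>?P'\<^esub> m q"
      by (simp add: e m_def f_product_def)
  qed
  have hin: "h x \<in> carrier ?P" if "x \<in> carrier A" for x
    using that bij by (auto simp: bij_betw_def)
  have m1: "m \<one>\<^bsub>?P\<^esub> = \<one>\<^bsub>?P'\<^esub>"
    by (simp add: m_def f_product_def B'_def C'_def)
  have "m \<circ> h \<in> hoop_iso A ?P'"
    using h bij_betw_trans[OF bij mbij] hin mmult mimp m1 bij_betwE[OF mbij]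
    by (auto simp: hoop_iso_def iso_def hom_def)
  then have "trivial_hoop B' \<or> trivial_hoop C'"
    using irr hB' hC' f' unfolding irreducible_hoop_def by blast
  then show ?thesis
    using trivial_transport[OF B u] trivial_transport[OF C v] by (auto simp: B'_def C'_def)
qed

end

theory Submission
  imports Defs
begin

text \<open>
  If \<open>A\<close> is isomorphic to \<open>B \<ltimes>\<^sub>f C\<close>, the kernel of the projection onto \<open>C\<close> is a congruence; it is
  trivial only if \<open>B\<close> is, and total only if \<open>C\<close> is.

  Conversely, let \<open>e\<close> be a maximal idempotent below \<open>1\<close> of a finite hoop \<open>A\<close>. Every \<open>u \<noteq> 1\<close> above
  \<open>e\<close> has \<open>e\<close> among its powers. It follows that \<open>e \<rightarrow> a\<close> either lies below \<open>e\<close> or has with \<open>e\<close> no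
  common upper bound except \<open>1\<close>. Letting \<open>f\<close> take the value \<open>e\<close> in the first case and \<open>1\<close> in the
  second, \<open>a \<mapsto> ((a \<rightarrow> e) \<rightarrow> e, e \<cdot> a)\<close> is an isomorphism of \<open>A\<close> onto the \<open>f\<close>-product of \<open>{b. e \<le> b}\<close>
  and \<open>{x. x \<le> e}\<close>; its first component is the join of \<open>a\<close> and \<open>e\<close>. If \<open>A\<close> is irreducible, \<open>e\<close> is
  therefore the least element. A congruence other than equality relates some \<open>u \<noteq> 1\<close> to \<open>1\<close>, hence
  also the power \<open>e\<close> of \<open>u\<close>, and so every element.
\<close>

section \<open>Residuated arithmetic and idempotent powers in a hoop\<close>

context hoop
begin

declare imp_closed [simp, intro]

abbreviation le (infix \<open>\<preceq>\<close> 50)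
  where "x \<preceq> y \<equiv> hoop_le A x y"

lemma le_iff_imp: "x \<preceq> y \<longleftrightarrow> x \<leadsto> y = \<one>"
  by (simp add: hoop_le_def)

lemma one_le:
  assumes "x \<in> carrier A" "\<one> \<preceq> x"
  shows "x = \<one>"
  using assms le_antisym[of x \<one>] le_one by simp

lemma residuation':
  "\<lbrakk>x \<in> carrier A; y \<in> carrier A; z \<in> carrier A\<rbrakk> \<Longrightarrow> y \<otimes> x \<preceq> z \<longleftrightarrow> x \<preceq> y \<leadsto> z"
  by (simp add: residuation m_comm)

lemma mult_le_left:
  assumes "x \<in> carrier A" "y \<in> carrier A"
  shows "x \<otimes> y \<preceq> x"
  using residuation'[of y x x] assms by (simp add: imp_refl le_one)

lemma mult_le_right:
  assumes "x \<in> carrier A" "y \<in> carrier A"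
  shows "x \<otimes> y \<preceq> y"
  using mult_le_left[of y x] assms by (simp add: m_comm)

lemma mult_imp_le:
  assumes "x \<in> carrier A" "y \<in> carrier A"
  shows "x \<otimes> (x \<leadsto> y) \<preceq> y"
  using hoop_meet_le2[of x y] assms by (simp add: hoop_meet_def)

lemma le_imp:
  assumes "x \<in> carrier A" "y \<in> carrier A"
  shows "y \<preceq> x \<leadsto> y"
  using residuation'[of y x y] mult_le_right[of x y] assms by simp

lemma mult_mono_left:
  assumes "x \<in> carrier A" "y \<in> carrier A" "z \<in> carrier A" "x \<preceq> y"
  shows "z \<otimes> x \<preceq> z \<otimes> y"
proof -
  have "y \<preceq> z \<leadsto> z \<otimes> y"
    using assms residuation'[of y z "z \<otimes> y"] le_refl by simp
  then have "x \<preceq> z \<leadsto> z \<otimes> y"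
    using assms le_trans[of x y] by simp
  then show ?thesis using assms residuation' by simp
qed

lemma mult_mono_right:
  assumes "x \<in> carrier A" "y \<in> carrier A" "z \<in> carrier A" "x \<preceq> y"
  shows "x \<otimes> z \<preceq> y \<otimes> z"
  using mult_mono_left[OF assms] assms by (simp add: m_comm)

lemma imp_mono:
  assumes "x \<in> carrier A" "y \<in> carrier A" "z \<in> carrier A" "x \<preceq> y"
  shows "z \<leadsto> x \<preceq> z \<leadsto> y"
  using assms residuation'[of "z \<leadsto> x" z y] mult_imp_le[of z x] le_trans[of _ x y] by simp

lemma imp_antimono:
  assumes "x \<in> carrier A" "y \<in> carrier A" "z \<in> carrier A" "x \<preceq> y"
  shows "y \<leadsto> z \<preceq> x \<leadsto> z"
proof -
  have "x \<otimes> (y \<leadsto> z) \<preceq> y \<otimes> (y \<leadsto> z)"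
    using assms mult_mono_right by simp
  then have "x \<otimes> (y \<leadsto> z) \<preceq> z"
    using assms mult_imp_le[of y z] le_trans[of "x \<otimes> (y \<leadsto> z)" "y \<otimes> (y \<leadsto> z)" z] by simp
  then show ?thesis using assms residuation' by simp
qed

lemma le_imp_imp:
  assumes "x \<in> carrier A" "y \<in> carrier A"
  shows "x \<preceq> (x \<leadsto> y) \<leadsto> y"
  using assms residuation[of x "x \<leadsto> y" y] mult_imp_le by simp

lemma imp_commute:
  assumes "x \<in> carrier A" "y \<in> carrier A" "z \<in> carrier A"
  shows "x \<leadsto> (y \<leadsto> z) = y \<leadsto> (x \<leadsto> z)"
  using assms imp_curry[of x y z] imp_curry[of y x z] by (simp add: m_comm)

lemma mult_imp_eq:
  assumes "x \<in> carrier A" "y \<in> carrier A" "x \<preceq> y"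
  shows "y \<otimes> (y \<leadsto> x) = x"
  using divisible[of x y] assms by (simp add: hoop_le_def)

lemma pow_le:
  assumes u: "u \<in> carrier A" and mn: "m \<le> (n::nat)"
  shows "u [^] n \<preceq> u [^] m"
  using mult_le_left[of "u [^] m" "u [^] (n - m)"] u mn by (simp add: nat_pow_mult)

lemma idem_pow:
  assumes e: "e \<in> carrier A" and "e \<otimes> e = e" and u: "u \<in> carrier A" and "e \<preceq> u"
  shows "e \<preceq> u [^] (n::nat)"
proof (induction n)
  case 0
  then show ?case using e le_one by simp
next
  case (Suc n)
  have "e \<preceq> u [^] n \<otimes> e"
    using mult_mono_right[OF _ _ _ Suc, of e] assms by simp
  moreover have "u [^] n \<otimes> e \<preceq> u [^] n \<otimes> u"
    using mult_mono_left assms by simp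
  ultimately show ?case
    using le_trans[of e "u [^] n \<otimes> e" "u [^] n \<otimes> u"] e u by simp
qed

text \<open>The powers of \<open>u\<close> descend, and finiteness forces a repetition
  \<open>u [^] i = u [^] j\<close> with \<open>i < j\<close>. This squeezes
  \<open>u [^] Suc i\<close> between two equal powers, so the sequence is constant from
  \<open>i\<close> on.\<close>

lemma finite_idem_pow:
  assumes fin: "finite (carrier A)" and u: "u \<in> carrier A"
  obtains n :: nat where "0 < n" "u [^] n \<otimes> u [^] n = u [^] n"
proof -
  have "range (\<lambda>n::nat. u [^] n) \<subseteq> carrier A" using u by auto
  then have "\<not> inj (\<lambda>n::nat. u [^] n)"
    using fin finite_subset finite_imageD infinite_UNIV_nat by metis
  then obtain i j :: nat where ij: "i < j" "u [^] i = u [^] j"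
    unfolding inj_on_def by (metis linorder_neqE_nat)
  have const: "u [^] n = u [^] i" if "i \<le> n" for n
    using that
  proof (induction n rule: dec_induct)
    case (step n)
    have "u [^] Suc i \<preceq> u [^] i" "u [^] j \<preceq> u [^] Suc i"
      using pow_le[OF u, of i "Suc i"] pow_le[OF u, of "Suc i" j] ij by simp_all
    then have "u [^] Suc i = u [^] i"
      using ij(2) u le_antisym[of "u [^] Suc i" "u [^] i"] by (simp del: nat_pow_Suc)
    then show ?case using step by simp
  qed simp
  \<comment> \<open>The larger index \<open>j\<close> is used because it is positive, while
    \<open>i\<close> may be 0.\<close>
  have "u [^] j \<otimes> u [^] j = u [^] j"
    using const[of "j + j"] ij u by (simp add: nat_pow_mult)
  then show thesis using that[of j] ij by simp
qed

end


text \<open>In a finite hoop, \<open>pow_e\<close> says that \<open>e\<close> is a maximal idempotent below \<open>1\<close>; it is also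
  satisfied by \<open>e = 1\<close>.\<close>

locale hoop_coatom = hoop +
  fixes e
  assumes e_closed [simp, intro]: "e \<in> carrier A"
    and e_idem: "e \<otimes> e = e"
    and pow_e: "\<lbrakk>u \<in> carrier A; e \<preceq> u; u \<noteq> \<one>\<rbrakk> \<Longrightarrow> \<exists>n::nat. u [^] n = e"
begin

section \<open>Elements above \<open>e\<close>, elements below \<open>e\<close>, and the dichotomy
  for \<open>e \<leadsto> a\<close>\<close>

lemma mult_e_of_fixed:
  assumes u: "u \<in> carrier A" "e \<preceq> u" "u \<noteq> \<one>" and y: "y \<in> carrier A" and uy: "u \<otimes> y = y"
  shows "e \<otimes> y = y"
proof -
  obtain n :: nat where n: "u [^] n = e" using pow_e u by blast
  have "u [^] n \<otimes> y = y" for n :: nat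
    by (induction n) (use u y uy in \<open>auto simp: m_assoc\<close>)
  then show ?thesis using n by metis
qed

text \<open>As for multiplication: by currying, the fixed point passes from \<open>u\<close> to all
  its powers, and \<open>e\<close> is one of them.\<close>

lemma imp_e_of_fixed:
  assumes u: "u \<in> carrier A" "e \<preceq> u" "u \<noteq> \<one>" and y: "y \<in> carrier A" and uy: "u \<leadsto> y = y"
  shows "e \<leadsto> y = y"
proof -
  obtain n :: nat where n: "u [^] n = e" using pow_e u by blast
  have "u [^] n \<leadsto> y = y" for n :: nat
    by (induction n) (use u y uy in \<open>auto simp: one_imp imp_curry\<close>)
  then show ?thesis using n by metis
qed

lemma mult_e_le: "x \<in> carrier A \<Longrightarrow> x \<preceq> e \<Longrightarrow> e \<otimes> x = x"
proof -
  assume x: "x \<in> carrier A" "x \<preceq> e"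
  have "e \<otimes> x = e \<otimes> (e \<otimes> (e \<leadsto> x))"
    using mult_imp_eq[of x e] x by simp
  also have "\<dots> = (e \<otimes> e) \<otimes> (e \<leadsto> x)" using x by (simp add: m_assoc)
  also have "\<dots> = x"
    using mult_imp_eq[of x e] x e_idem by simp
  finally show ?thesis .
qed

lemma mult_e_ge:
  assumes "x \<in> carrier A" "e \<preceq> x"
  shows "x \<otimes> e = e"
proof (rule le_antisym)
  show "e \<preceq> x \<otimes> e" using mult_mono_right[of e x e] assms e_idem by simp
qed (use assms mult_le_right in auto)

text \<open>Together with \<open>imp_e_mult\<close> this shows that \<open>e \<otimes> x\<close> and
  \<open>e \<leadsto> x\<close> determine each other. The nontrivial inequality is
  \<open>mult_imp_le\<close> multiplied by the idempotent \<open>e\<close>.\<close>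

lemma e_mult_imp: "x \<in> carrier A \<Longrightarrow> e \<otimes> (e \<leadsto> x) = e \<otimes> x"
proof (rule le_antisym)
  assume x: "x \<in> carrier A"
  have "e \<otimes> (e \<otimes> (e \<leadsto> x)) \<preceq> e \<otimes> x"
    using x mult_mono_left mult_imp_le by simp
  then show "e \<otimes> (e \<leadsto> x) \<preceq> e \<otimes> x" using x e_idem by (simp flip: m_assoc)
  show "e \<otimes> x \<preceq> e \<otimes> (e \<leadsto> x)" using x mult_mono_left le_imp by simp
qed auto

lemma imp_e_mult:
  assumes x: "x \<in> carrier A"
  shows "e \<leadsto> e \<otimes> x = e \<leadsto> x"
proof (rule le_antisym)
  show "e \<leadsto> e \<otimes> x \<preceq> e \<leadsto> x" using x imp_mono mult_le_right by simp
  show "e \<leadsto> x \<preceq> e \<leadsto> e \<otimes> x"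
    using x residuation'[of "e \<leadsto> x" e "e \<otimes> x"] le_refl by (simp add: e_mult_imp)
qed (use x in auto)

lemma mult_le_e: "x \<in> carrier A \<Longrightarrow> y \<in> carrier A \<Longrightarrow> x \<preceq> e \<Longrightarrow> x \<otimes> y \<preceq> e"
  using le_trans[of "x \<otimes> y" x e] mult_le_left[of x y] by simp

lemma ge_mult:
  assumes "x \<in> carrier A" "y \<in> carrier A" "e \<preceq> x" "e \<preceq> y"
  shows "e \<preceq> x \<otimes> y"
  using mult_mono_left[of e y x] assms by (simp add: mult_e_ge)

lemma ge_imp:
  assumes "x \<in> carrier A" "y \<in> carrier A" "e \<preceq> y"
  shows "e \<preceq> x \<leadsto> y"
  using le_trans[of e y "x \<leadsto> y"] le_imp assms by simp

text \<open>Since \<open>e \<leadsto> ?P = ?P\<close>, antitonicity also gives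
  \<open>u \<leadsto> ?P = ?P\<close>, which divisibility turns into
  \<open>u \<otimes> ?P = ?P\<close>. If \<open>u\<close> were not 1, its power \<open>e\<close>
  would fix \<open>?P\<close> as well, putting \<open>?P\<close> below \<open>e\<close>.\<close>

lemma e_join_top:
  assumes a: "a \<in> carrier A" and n: "\<not> e \<leadsto> a \<preceq> e"
    and u: "u \<in> carrier A" "e \<preceq> u" "e \<leadsto> a \<preceq> u"
  shows "u = \<one>"
proof (rule ccontr)
  assume u1: "u \<noteq> \<one>"
  let ?P = "e \<leadsto> a"
  have "u \<leadsto> ?P \<preceq> e \<leadsto> ?P" using a u imp_antimono by simp
  also have "e \<leadsto> ?P = ?P" using a imp_curry[of e e a] e_idem by simp
  finally have "u \<leadsto> ?P = ?P" using a u le_imp le_antisym[of "u \<leadsto> ?P"] by simp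
  then have "u \<otimes> ?P = ?P" using mult_imp_eq[of ?P u] a u by simp
  then have "e \<otimes> ?P = ?P" using mult_e_of_fixed u u1 a by simp
  then show False using n mult_le_left[of e ?P] a by simp
qed

lemma imp_fixes_ge:
  assumes a: "a \<in> carrier A" and n: "\<not> e \<leadsto> a \<preceq> e" and b: "b \<in> carrier A" "e \<preceq> b"
  shows "(e \<leadsto> a) \<leadsto> b = b"
proof -
  let ?P = "e \<leadsto> a"
  \<comment> \<open>This element lies above \<open>?P\<close>, and above \<open>b\<close>, hence
    above \<open>e\<close>.\<close>
  have "(?P \<leadsto> b) \<leadsto> b = \<one>"
    using e_join_top[OF a n] a b le_imp_imp ge_imp by simp
  then show ?thesis
    using le_antisym[of "?P \<leadsto> b" b] le_imp a b by (simp add: le_iff_imp)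
qed

section \<open>Double negation relative to \<open>e\<close>, as the join with
  \<open>e\<close>\<close>

abbreviation nn where "nn a \<equiv> (a \<leadsto> e) \<leadsto> e"

lemma nn_ge: "a \<in> carrier A \<Longrightarrow> e \<preceq> nn a"
  by (simp add: ge_imp le_refl)

lemma nn_le_e: "a \<in> carrier A \<Longrightarrow> a \<preceq> e \<Longrightarrow> nn a = e"
  by (simp add: le_iff_imp one_imp)

lemma nn_mono: "\<lbrakk>a \<in> carrier A; b \<in> carrier A; a \<preceq> b\<rbrakk> \<Longrightarrow> nn a \<preceq> nn b"
  by (simp add: imp_antimono)

text \<open>Makes \<open>nn\<close> a closure operator whose closed elements are exactly those above
  \<open>e\<close>. If \<open>?w\<close> is not 1, it fixes \<open>s \<leadsto> e\<close>, by triple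
  negation and \<open>s = ?w \<otimes> nn s\<close>. Then \<open>e\<close> fixes it too, and
  exchanging premises gives \<open>s \<leadsto> e = \<one>\<close>, so \<open>s = e\<close>.\<close>

lemma nn_eq:
  assumes s: "s \<in> carrier A" "e \<preceq> s"
  shows "nn s = s"
proof (cases "nn s \<leadsto> s = \<one>")
  case True
  then show ?thesis using s le_imp_imp[of s e] le_antisym[of "nn s" s] by (simp add: le_iff_imp)
next
  case False
  let ?w = "nn s \<leadsto> s"
  have "nn s \<leadsto> e \<preceq> s \<leadsto> e" "s \<leadsto> e \<preceq> nn s \<leadsto> e"
    using s imp_antimono[of s "nn s" e] le_imp_imp[of s e] le_imp_imp[of "s \<leadsto> e" e] by simp_all
  then have nnn: "nn s \<leadsto> e = s \<leadsto> e" using s le_antisym[of "nn s \<leadsto> e"] by simp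
  have "s = ?w \<otimes> nn s"
    using mult_imp_eq[of s "nn s"] s le_imp_imp[of s e] by (simp add: m_comm)
  then have "s \<leadsto> e = ?w \<leadsto> (s \<leadsto> e)"
    using imp_curry[of ?w "nn s" e] s nnn by simp
  then have "e \<leadsto> (s \<leadsto> e) = s \<leadsto> e"
    using imp_e_of_fixed[of ?w "s \<leadsto> e"] False s ge_imp by simp
  then have "s \<leadsto> e = \<one>" using imp_commute[of e s e] s by (simp add: imp_refl imp_one)
  then have "s = e" using s le_antisym[of s e] by (simp add: le_iff_imp)
  then show ?thesis by (simp add: imp_refl one_imp)
qed

text \<open>The factor \<open>e \<leadsto> a\<close> disappears from
  \<open>s \<otimes> (e \<leadsto> a) \<leadsto> e\<close> after currying, because
  \<open>e \<leadsto> a\<close> fixes \<open>e\<close> under implication.\<close>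

lemma nn_mult_closed:
  assumes a: "a \<in> carrier A" and n: "\<not> e \<leadsto> a \<preceq> e" and s: "s \<in> carrier A" "e \<preceq> s"
  shows "nn (s \<otimes> (e \<leadsto> a)) = s"
  using assms imp_fixes_ge[OF a n, of e] nn_eq by (simp add: imp_curry le_refl)

text \<open>Divisibility writes \<open>a\<close> as \<open>?s \<otimes> ?P\<close> with
  \<open>?s\<close> above \<open>e\<close>; \<open>nn_mult_closed\<close> then identifies
  \<open>?s\<close> as \<open>nn a\<close>.\<close>

lemma nn_decomp:
  assumes a: "a \<in> carrier A" and n: "\<not> e \<leadsto> a \<preceq> e"
  shows "nn a \<otimes> (e \<leadsto> a) = a"
proof -
  let ?P = "e \<leadsto> a" and ?s = "(e \<leadsto> a) \<leadsto> a"
  have "?s \<otimes> ?P = a"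
    using mult_imp_eq[of a ?P] a le_imp by (simp add: m_comm)
  moreover have "nn (?s \<otimes> ?P) = ?s"
    using nn_mult_closed[OF a n, of ?s] a le_imp_imp[of e a] by simp
  ultimately show ?thesis by simp
qed

lemma le_of_closed_le:
  assumes a: "a \<in> carrier A" and "e \<leadsto> a \<preceq> e"
  shows "e \<leadsto> a \<preceq> a"
  using mult_e_le[of "e \<leadsto> a"] assms mult_imp_le[of e a] by simp

text \<open>The order can be tested on the two components of \<open>split_at\<close>, whence its
  injectivity. If \<open>?P\<close> is not below \<open>e\<close>, then
  \<open>z \<leadsto> b\<close> is above both \<open>e\<close> and \<open>?P\<close>, so it is 1;
  otherwise \<open>z\<close> is below \<open>?P\<close>, which is below \<open>b\<close>.\<close>

lemma le_if_nn:
  assumes z: "z \<in> carrier A" and b: "b \<in> carrier A"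
    and 1: "z \<preceq> nn b" and 2: "e \<otimes> z \<preceq> b"
  shows "z \<preceq> b"
proof -
  let ?P = "e \<leadsto> b"
  have zP: "z \<preceq> ?P" using 2 z b by (simp add: residuation')
  show ?thesis
  proof (cases "?P \<preceq> e")
    case True
    then show ?thesis using le_of_closed_le zP le_trans[of z ?P b] z b by simp
  next
    case False
    have "z \<otimes> ?P \<preceq> nn b \<otimes> ?P" using z b 1 mult_mono_right by simp
    then have "?P \<preceq> z \<leadsto> b" using nn_decomp[OF b False] z b residuation' by simp
    moreover have "e \<preceq> z \<leadsto> b" using 2 z b residuation by simp
    ultimately show ?thesis using e_join_top[OF b False, of "z \<leadsto> b"] z b by (simp add: le_iff_imp)
  qed
qed

lemma le_closed: "a \<in> carrier A \<Longrightarrow> e \<leadsto> a \<preceq> e \<Longrightarrow> a \<preceq> e"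
  using le_trans[of a "e \<leadsto> a" e] le_imp by simp

text \<open>A primeness property, on which the multiplicativity of \<open>glue\<close> rests. From
  \<open>e \<otimes> (?P \<otimes> ?Q) = e \<otimes> (a \<otimes> b)\<close> one gets
  \<open>?P\<close> below \<open>?Q \<leadsto> e\<close>, and the latter equals \<open>e\<close>
  unless \<open>?Q\<close> is below \<open>e\<close>.\<close>

lemma closed_mult_le:
  assumes a: "a \<in> carrier A" and b: "b \<in> carrier A"
  shows "e \<leadsto> a \<otimes> b \<preceq> e \<longleftrightarrow> e \<leadsto> a \<preceq> e \<or> e \<leadsto> b \<preceq> e"
proof
  let ?P = "e \<leadsto> a" and ?Q = "e \<leadsto> b"
  assume ab: "e \<leadsto> a \<otimes> b \<preceq> e"
  have *: "e \<otimes> (x \<otimes> y) = (e \<otimes> x) \<otimes> (e \<otimes> y)" if "x \<in> carrier A" "y \<in> carrier A" for x y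
  proof -
    have "(e \<otimes> x) \<otimes> (e \<otimes> y) = (e \<otimes> e) \<otimes> (x \<otimes> y)" using that by (simp add: m_ac)
    then show ?thesis using e_idem by simp
  qed
  have "e \<otimes> (?P \<otimes> ?Q) = e \<otimes> (a \<otimes> b)"
    using a b by (simp add: * e_mult_imp)
  then have "e \<otimes> (?P \<otimes> ?Q) \<preceq> a \<otimes> b" using a b mult_le_right by simp
  then have "?P \<otimes> ?Q \<preceq> e"
    using ab a b le_trans[of "?P \<otimes> ?Q" "e \<leadsto> a \<otimes> b" e] residuation' by simp
  then have "?P \<preceq> ?Q \<leadsto> e" using a b residuation by simp
  show "?P \<preceq> e \<or> ?Q \<preceq> e"
  proof (rule disjCI)
    assume "\<not> ?Q \<preceq> e"
    then show "?P \<preceq> e" using imp_fixes_ge[OF b, of e] \<open>?P \<preceq> ?Q \<leadsto> e\<close> le_refl by simp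
  qed
next
  assume "e \<leadsto> a \<preceq> e \<or> e \<leadsto> b \<preceq> e"
  then show "e \<leadsto> a \<otimes> b \<preceq> e"
    using a b le_trans[of "e \<leadsto> a \<otimes> b" "e \<leadsto> a" e] le_trans[of "e \<leadsto> a \<otimes> b" "e \<leadsto> b" e]
      imp_mono mult_le_left mult_le_right by auto
qed

lemma nn_mult:
  assumes a: "a \<in> carrier A" and b: "b \<in> carrier A"
  shows "nn (a \<otimes> b) = nn a \<otimes> nn b"
proof -
  consider "a \<preceq> e" | "b \<preceq> e" | "\<not> e \<leadsto> a \<preceq> e" "\<not> e \<leadsto> b \<preceq> e"
    using le_closed a b by blast
  then show ?thesis
  proof cases
    case 1
    then have "a \<otimes> b \<preceq> e" using a b mult_le_e by simp
    then show ?thesis using 1 a b mult_e_ge[of "nn b"] nn_ge by (simp add: nn_le_e m_comm)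
  next
    case 2
    then have "a \<otimes> b \<preceq> e" using a b mult_le_e[of b a] by (simp add: m_comm)
    then show ?thesis using 2 a b mult_e_ge[of "nn a"] nn_ge by (simp add: nn_le_e)
  next
    \<comment> \<open>Both arguments decompose by \<open>nn_decomp\<close>, and the factors
      \<open>?P\<close> and \<open>?Q\<close> do not affect the negation.\<close>
    case 3
    let ?P = "e \<leadsto> a" and ?Q = "e \<leadsto> b"
    have "a \<otimes> b = (nn a \<otimes> ?P) \<otimes> (nn b \<otimes> ?Q)" using nn_decomp 3 a b by simp
    also have "\<dots> = ((nn a \<otimes> nn b) \<otimes> ?P) \<otimes> ?Q" using a b by (simp add: m_ac)
    finally have "a \<otimes> b \<leadsto> e = ((nn a \<otimes> nn b) \<otimes> ?P) \<leadsto> e"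
      using a b imp_fixes_ge[OF b 3(2), of e] by (simp add: imp_curry le_refl)
    then show ?thesis
      using nn_mult_closed[OF a 3(1), of "nn a \<otimes> nn b"] a b by (simp add: ge_mult nn_ge)
  qed
qed

text \<open>In the excluded case \<open>nn (a \<leadsto> b)\<close> is \<open>e\<close>, which the
  value \<open>e\<close> of \<open>glue\<close> supplies in the product.\<close>

lemma nn_imp:
  assumes a: "a \<in> carrier A" and b: "b \<in> carrier A" and n: "\<not> e \<leadsto> (a \<leadsto> b) \<preceq> e"
  shows "nn (a \<leadsto> b) = nn a \<leadsto> nn b"
proof (rule le_antisym)
  have "nn (a \<otimes> (a \<leadsto> b)) \<preceq> nn b" using a b nn_mono mult_imp_le by simp
  then show "nn (a \<leadsto> b) \<preceq> nn a \<leadsto> nn b" using a b by (simp add: nn_mult residuation')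
  let ?R = "e \<leadsto> (a \<leadsto> b)" and ?w = "nn a \<leadsto> nn b"
  let ?v = "?R \<leadsto> (a \<leadsto> b)"
  have "?v \<otimes> ?R = a \<leadsto> b"
    using mult_imp_eq[of "a \<leadsto> b" ?R] a b le_imp by (simp add: m_comm)
  moreover have "nn (?v \<otimes> ?R) = ?v"
    using nn_mult_closed[OF _ n, of ?v] a b le_imp_imp[of e "a \<leadsto> b"] by simp
  ultimately have v: "nn (a \<leadsto> b) = ?v" by simp
  \<comment> \<open>By residuation this is \<open>?w \<preceq> ?v\<close>, where \<open>?v\<close>
    is \<open>nn (a \<leadsto> b)\<close>. The test of \<open>le_if_nn\<close> applies; its second
    condition uses \<open>e \<otimes> ?R = e \<otimes> (a \<leadsto> b)\<close>.\<close>
  have "(?w \<otimes> ?R) \<otimes> a \<preceq> b"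
  proof (rule le_if_nn)
    have "a \<otimes> ?w \<preceq> nn a \<otimes> ?w" using a b mult_mono_right le_imp_imp by simp
    then have "a \<otimes> ?w \<preceq> nn b"
      using mult_imp_le[of "nn a" "nn b"] a b le_trans[of "a \<otimes> ?w" "nn a \<otimes> ?w" "nn b"] by simp
    moreover have "(?w \<otimes> ?R) \<otimes> a = (a \<otimes> ?w) \<otimes> ?R" using a b by (simp add: m_ac)
    ultimately show "(?w \<otimes> ?R) \<otimes> a \<preceq> nn b"
      using mult_le_left[of "a \<otimes> ?w" ?R] a b le_trans[of "(a \<otimes> ?w) \<otimes> ?R" "a \<otimes> ?w" "nn b"] by simp
    have "e \<otimes> ((?w \<otimes> ?R) \<otimes> a) = ?w \<otimes> (a \<otimes> (e \<otimes> ?R))" using a b by (simp add: m_ac)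
    also have "\<dots> = (?w \<otimes> e) \<otimes> (a \<otimes> (a \<leadsto> b))" using a b by (simp add: e_mult_imp m_ac)
    finally show "e \<otimes> ((?w \<otimes> ?R) \<otimes> a) \<preceq> b"
      using a b mult_le_right[of "?w \<otimes> e" "a \<otimes> (a \<leadsto> b)"] mult_imp_le[of a b]
        le_trans[of "(?w \<otimes> e) \<otimes> (a \<otimes> (a \<leadsto> b))" "a \<otimes> (a \<leadsto> b)" b] by simp
  qed (use a b in auto)
  then have "?w \<preceq> ?v" using a b residuation by simp
  then show "?w \<preceq> nn (a \<leadsto> b)" using v by simp
qed (use a b in auto)

section \<open>The two factors and the product morphism\<close>

definition Up :: "'a hoop_alg"
  where "Up = \<lparr>carrier = {b \<in> carrier A. e \<preceq> b}, mult = (\<otimes>), one = \<one>, himp = (\<leadsto>)\<rparr>"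

text \<open>The quotient of \<open>A\<close> by the filter \<open>Up\<close>: each class is represented by its least element
  \<open>e \<cdot> a\<close>; its greatest element is \<open>e \<rightarrow> a\<close>.\<close>

definition Down :: "'a hoop_alg"
  where "Down = \<lparr>carrier = {x \<in> carrier A. x \<preceq> e}, mult = (\<otimes>), one = e,
    himp = (\<lambda>x y. e \<otimes> (x \<leadsto> y))\<rparr>"

definition glue :: "'a \<Rightarrow> 'a"
  where "glue x = (if e \<leadsto> x \<preceq> e then e else \<one>)"

lemma hoop_Up: "hoop Up"
proof (intro hoop.intro hoop_axioms.intro comm_monoidI)
  fix x y assume "x \<in> carrier Up" "y \<in> carrier Up"
  then show "x \<otimes>\<^bsub>Up\<^esub> (x \<leadsto>\<^bsub>Up\<^esub> y) = y \<otimes>\<^bsub>Up\<^esub> (y \<leadsto>\<^bsub>Up\<^esub> x)"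
    using divisible by (simp add: Up_def)
  show "x \<otimes>\<^bsub>Up\<^esub> y = y \<otimes>\<^bsub>Up\<^esub> x"
    using \<open>x \<in> carrier Up\<close> \<open>y \<in> carrier Up\<close> m_comm by (simp add: Up_def)
qed (auto simp: Up_def m_assoc imp_refl imp_curry ge_mult ge_imp le_one)

text \<open>Removes the inner factor \<open>e\<close> that appears when implications of
  \<open>Down\<close> are nested, as in its currying law.\<close>

lemma imp_mult_e_right:
  assumes "x \<in> carrier A" "x \<preceq> e" "w \<in> carrier A"
  shows "x \<leadsto> e \<otimes> w = x \<leadsto> w"
proof -
  have xe: "x \<otimes> e = x" using mult_e_le[of x] assms by (simp add: m_comm)
  then have "x \<leadsto> e \<otimes> w = (x \<otimes> e) \<leadsto> e \<otimes> w" by simp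
  also have "\<dots> = (x \<otimes> e) \<leadsto> w"
    using assms by (simp add: imp_curry imp_e_mult)
  also have "\<dots> = x \<leadsto> w"
    using xe by simp
  finally show ?thesis .
qed

lemma hoop_Down: "hoop Down"
proof (intro hoop.intro hoop_axioms.intro comm_monoidI)
  fix x y assume xy: "x \<in> carrier Down" "y \<in> carrier Down"
  show "x \<otimes>\<^bsub>Down\<^esub> y = y \<otimes>\<^bsub>Down\<^esub> x"
    using xy m_comm by (simp add: Down_def)
  have "x \<otimes> (e \<otimes> (x \<leadsto> y)) = (e \<otimes> x) \<otimes> (x \<leadsto> y)"
    "y \<otimes> (e \<otimes> (y \<leadsto> x)) = (e \<otimes> y) \<otimes> (y \<leadsto> x)"
    using xy by (simp_all add: Down_def m_ac)
  then show "x \<otimes>\<^bsub>Down\<^esub> (x \<leadsto>\<^bsub>Down\<^esub> y) = y \<otimes>\<^bsub>Down\<^esub> (y \<leadsto>\<^bsub>Down\<^esub> x)"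
    using xy mult_e_le divisible[of x y] by (simp add: Down_def)
  show "x \<otimes>\<^bsub>Down\<^esub> y \<in> carrier Down" "x \<leadsto>\<^bsub>Down\<^esub> y \<in> carrier Down"
    using xy mult_le_e mult_le_left by (simp_all add: Down_def)
  fix z assume "z \<in> carrier Down"
  then show "(x \<otimes>\<^bsub>Down\<^esub> y) \<leadsto>\<^bsub>Down\<^esub> z = x \<leadsto>\<^bsub>Down\<^esub> (y \<leadsto>\<^bsub>Down\<^esub> z)"
    using xy by (simp add: Down_def imp_curry imp_mult_e_right)
qed (auto simp: Down_def m_assoc imp_refl le_refl mult_e_le)

lemma meet_Up: "hoop_meet Up = hoop_meet A"
  by (intro ext) (simp add: hoop_meet_def Up_def)

lemma le_Up: "hoop_le Up = hoop_le A"
  by (intro ext) (simp add: hoop_le_def Up_def)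

lemma meet_Down:
  assumes "x \<in> carrier A" "y \<in> carrier A" "x \<preceq> e"
  shows "hoop_meet Down x y = hoop_meet A x y"
proof -
  have "x \<otimes> (e \<otimes> (x \<leadsto> y)) = (e \<otimes> x) \<otimes> (x \<leadsto> y)" using assms by (simp add: m_ac)
  then show ?thesis using assms mult_e_le by (simp add: hoop_meet_def Down_def)
qed

lemma mult_le_meet:
  assumes "x \<in> carrier A" "y \<in> carrier A"
  shows "x \<otimes> y \<preceq> hoop_meet A x y"
  using assms mult_mono_left le_imp by (simp add: hoop_meet_def)

text \<open>The meet lies between the product and each argument, so \<open>closed_mult_le\<close>
  carries over by monotonicity.\<close>

lemma closed_meet_le:
  assumes a: "a \<in> carrier A" and b: "b \<in> carrier A"
  shows "e \<leadsto> hoop_meet A a b \<preceq> e \<longleftrightarrow> e \<leadsto> a \<preceq> e \<or> e \<leadsto> b \<preceq> e"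
proof -
  have mono: "e \<leadsto> x \<preceq> e" if "x \<in> carrier A" "y \<in> carrier A" "x \<preceq> y" "e \<leadsto> y \<preceq> e" for x y
    using that imp_mono[of x y e] le_trans[of "e \<leadsto> x" "e \<leadsto> y" e] by simp
  show ?thesis
    using mono[of "a \<otimes> b" "hoop_meet A a b"] mono[of "hoop_meet A a b"] mult_le_meet
      closed_mult_le[OF a b] hoop_meet_le1 hoop_meet_le2 meet_closed a b
    by (metis m_closed)
qed

lemma product_morphism_glue: "product_morphism Down Up glue"
proof -
  have "glue x \<otimes> glue y = glue (x \<otimes> y)" "hoop_meet A (glue x) (glue y) = glue (x \<otimes> y)"
    "glue (x \<otimes> y) = glue (hoop_meet A x y)"
    if "x \<in> carrier A" "y \<in> carrier A" for x y
    unfolding glue_def closed_mult_le[OF that] closed_meet_le[OF that]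
    by (auto simp: hoop_meet_def imp_refl one_imp imp_one e_idem)
  moreover have "carrier Up = {b \<in> carrier A. e \<preceq> b}" "carrier Down = {x \<in> carrier A. x \<preceq> e}"
    "\<And>x y. x \<otimes>\<^bsub>Up\<^esub> y = x \<otimes> y" "\<And>x y. x \<otimes>\<^bsub>Down\<^esub> y = x \<otimes> y"
    "\<one>\<^bsub>Up\<^esub> = \<one>" "\<one>\<^bsub>Down\<^esub> = e"
    by (simp_all add: Up_def Down_def)
  \<comment> \<open>\<open>e \<leadsto> e\<close> is 1, so the first branch of \<open>glue\<close>
    is taken only if \<open>e\<close> is itself 1.\<close>
  moreover have "glue e = \<one>" "\<And>x. glue x \<in> carrier A" "\<And>x. e \<preceq> glue x"
    using one_le by (auto simp: glue_def le_refl le_one imp_refl)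
  ultimately show ?thesis
    by (auto simp: product_morphism_def meet_Up meet_Down)
qed

section \<open>The isomorphism onto the product\<close>

definition split_at :: "'a \<Rightarrow> 'a \<times> 'a"
  where "split_at a = (nn a, e \<otimes> a)"

lemma glue_mult_e: "a \<in> carrier A \<Longrightarrow> glue (e \<otimes> a) = (if e \<leadsto> a \<preceq> e then e else \<one>)"
  by (simp add: glue_def imp_e_mult)

lemma carrier_prod: "carrier (f_product Up glue Down) =
    {(b, x). b \<in> carrier A \<and> e \<preceq> b \<and> x \<in> carrier A \<and> x \<preceq> e \<and> b \<preceq> glue x}"
  by (auto simp: f_product_def le_Up) (auto simp: Up_def Down_def)

lemma split_at_closed:
  assumes a: "a \<in> carrier A"
  shows "split_at a \<in> carrier (f_product Up glue Down)"
proof -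
  have "nn a \<preceq> glue (e \<otimes> a)"
    using a le_closed nn_le_e by (auto simp: glue_mult_e le_one le_refl)
  then show ?thesis
    using a nn_ge mult_le_left by (simp add: split_at_def carrier_prod)
qed

lemma split_at_inj: "inj_on split_at (carrier A)"
proof (rule inj_onI)
  have *: "a \<preceq> b" if "a \<in> carrier A" "b \<in> carrier A" "split_at a = split_at b" for a b
    using that le_if_nn[of a b] le_imp_imp[of a e] mult_le_right[of e b] by (simp add: split_at_def)
  fix a b assume "a \<in> carrier A" "b \<in> carrier A" "split_at a = split_at b"
  then show "a = b" using * le_antisym by simp
qed

lemma split_at_surj:
  assumes p: "p \<in> carrier (f_product Up glue Down)"
  shows "p \<in> split_at ` carrier A"
proof -
  obtain b x where bx: "p = (b, x)" "b \<in> carrier A" "e \<preceq> b" "x \<in> carrier A" "x \<preceq> e" "b \<preceq> glue x"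
    using p by (auto simp: carrier_prod)
  show ?thesis
  proof (cases "e \<leadsto> x \<preceq> e")
    case True
    \<comment> \<open>Here \<open>glue x = e\<close> leaves \<open>e\<close> as the only possible
      first component, and \<open>x\<close> itself is the preimage.\<close>
    then have "b = e" using bx le_antisym by (simp add: glue_def)
    then have "p = split_at x" using bx by (simp add: split_at_def nn_le_e mult_e_le)
    then show ?thesis using bx by blast
  next
    case False
    \<comment> \<open>The preimage \<open>b \<otimes> (e \<leadsto> x)\<close> is the one suggested
      by \<open>nn_decomp\<close>.\<close>
    have "e \<otimes> (b \<otimes> (e \<leadsto> x)) = (b \<otimes> e) \<otimes> (e \<leadsto> x)" using bx by (simp add: m_ac)
    also have "\<dots> = x" using bx by (simp add: mult_e_ge e_mult_imp mult_e_le)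
    finally have "p = split_at (b \<otimes> (e \<leadsto> x))"
      using bx False nn_mult_closed by (simp add: split_at_def)
    then show ?thesis using bx by blast
  qed
qed

lemma split_at_imp:
  assumes a: "a \<in> carrier A" and b: "b \<in> carrier A"
  shows "split_at (a \<leadsto> b) = split_at a \<leadsto>\<^bsub>f_product Up glue Down\<^esub> split_at b"
proof -
  have "e \<otimes> (e \<otimes> a \<leadsto> e \<otimes> b) = e \<otimes> (a \<leadsto> (e \<leadsto> b))"
    using a b by (simp add: imp_curry imp_commute[of e a] imp_e_mult)
  also have "\<dots> = e \<otimes> (a \<leadsto> b)"
    using a b by (simp add: imp_commute[of a e] e_mult_imp)
  finally have 1: "e \<otimes> (e \<otimes> a \<leadsto> e \<otimes> b) = e \<otimes> (a \<leadsto> b)" .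
  \<comment> \<open>The meet with \<open>glue\<close> gives \<open>e\<close> when
    \<open>a \<leadsto> b\<close> belongs to a class lying below \<open>e\<close>; otherwise it
    changes nothing and \<open>nn_imp\<close> applies.\<close>
  have 2: "hoop_meet A (glue (e \<otimes> (a \<leadsto> b))) (nn a \<leadsto> nn b) = nn (a \<leadsto> b)"
  proof (cases "e \<leadsto> (a \<leadsto> b) \<preceq> e")
    case True
    have "e \<otimes> (nn a \<leadsto> nn b) = e"
      using a b ge_imp nn_ge mult_e_ge[of "nn a \<leadsto> nn b"] m_comm[of e "nn a \<leadsto> nn b"] by simp
    then show ?thesis
      using True a b le_closed nn_le_e
      by (simp add: glue_mult_e hoop_meet_def e_mult_imp)
  next
    case False
    then show ?thesis
      using a b nn_imp by (simp add: glue_mult_e hoop_meet_def one_imp)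
  qed
  show ?thesis
    using 1 2 by (simp add: f_product_def split_at_def meet_Up) (simp add: Up_def Down_def)
qed

lemma split_at_iso: "split_at \<in> hoop_iso A (f_product Up glue Down)"
proof -
  have "split_at (a \<otimes> b) = split_at a \<otimes>\<^bsub>f_product Up glue Down\<^esub> split_at b"
    if ab: "a \<in> carrier A" "b \<in> carrier A" for a b
  proof -
    have "(e \<otimes> a) \<otimes> (e \<otimes> b) = (e \<otimes> e) \<otimes> (a \<otimes> b)" using ab by (simp add: m_ac)
    then show ?thesis using ab e_idem
      by (simp add: f_product_def split_at_def Up_def Down_def nn_mult)
  qed
  moreover have "split_at \<one> = \<one>\<^bsub>f_product Up glue Down\<^esub>"
    by (simp add: f_product_def split_at_def Up_def Down_def one_imp imp_refl)
  moreover have "bij_betw split_at (carrier A) (carrier (f_product Up glue Down))"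
    using split_at_inj split_at_closed split_at_surj by (auto simp: bij_betw_def)
  ultimately show ?thesis
    using split_at_closed split_at_imp by (simp add: hoop_iso_def iso_def hom_def)
qed

end


section \<open>Existence of \<open>e\<close>, and simplicity when \<open>e\<close> is least\<close>

context hoop
begin

lemma congruence_Id: "hoop_congruence A (Id_on (carrier A))"
  unfolding hoop_congruence_def equiv_def by (auto simp: refl_on_def sym_def trans_def)

lemma congruence_full: "hoop_congruence A (carrier A \<times> carrier A)"
  unfolding hoop_congruence_def equiv_def by (auto simp: refl_on_def sym_def trans_def)

text \<open>Maximality of \<open>e\<close> among idempotents other than 1 is obtained by minimizing
  the size of its up-set. An idempotent power of \<open>u\<close> above \<open>e\<close> has a
  smaller or equal up-set, so minimality makes the two coincide.\<close>

lemma exists_coatom: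
  assumes fin: "finite (carrier A)" and x: "x \<in> carrier A" "x \<noteq> \<one>"
  obtains e where "e \<noteq> \<one>" "hoop_coatom A e"
proof -
  let ?I = "\<lambda>e. e \<in> carrier A \<and> e \<noteq> \<one> \<and> e \<otimes> e = e"
  have pow_ne: "u [^] n \<noteq> \<one>" if "u \<in> carrier A" "u \<noteq> \<one>" "0 < n" for u and n :: nat
    using pow_le[of u 1 n] one_le[of u] that by auto
  obtain n :: nat where "0 < n" "x [^] n \<otimes> x [^] n = x [^] n"
    using finite_idem_pow[OF fin x(1)] .
  then have "?I (x [^] n)" using pow_ne x by auto
  then obtain e where e: "?I e"
    and min: "\<And>i. ?I i \<Longrightarrow> card {y \<in> carrier A. e \<preceq> y} \<le> card {y \<in> carrier A. i \<preceq> y}"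
    using ex_has_least_nat[of ?I _ "\<lambda>i. card {y \<in> carrier A. i \<preceq> y}"] by blast
  have "hoop_coatom A e"
  proof unfold_locales
    fix u assume u: "u \<in> carrier A" "e \<preceq> u" "u \<noteq> \<one>"
    obtain n :: nat where n: "0 < n" "u [^] n \<otimes> u [^] n = u [^] n"
      using finite_idem_pow[OF fin u(1)] .
    have le: "e \<preceq> u [^] n" using idem_pow e u by simp
    have "{y \<in> carrier A. u [^] n \<preceq> y} \<subseteq> {y \<in> carrier A. e \<preceq> y}"
      using le_trans[OF _ _ _ le] e u by auto
    then have "{y \<in> carrier A. u [^] n \<preceq> y} = {y \<in> carrier A. e \<preceq> y}"
      using min[of "u [^] n"] n pow_ne u fin by (intro card_seteq) auto
    then have "u [^] n \<preceq> e" using e le_refl by auto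
    then show "\<exists>n::nat. u [^] n = e" using le le_antisym e u by blast
  qed (use e in auto)
  then show thesis using that e by blast
qed

lemma simple_if_least_coatom:
  assumes e: "hoop_coatom A e" and least: "\<And>x. x \<in> carrier A \<Longrightarrow> e \<preceq> x"
  shows "simple_hoop A"
proof -
  interpret hoop_coatom A e by fact
  have "\<theta> = carrier A \<times> carrier A" if \<theta>: "hoop_congruence A \<theta>" and ne: "\<theta> \<noteq> Id_on (carrier A)" for \<theta>
  proof -
    have eq: "equiv (carrier A) \<theta>" using \<theta> by (simp add: hoop_congruence_def)
    note sub = equiv_type[OF eq]
    have r: "(x, x) \<in> \<theta>" if "x \<in> carrier A" for x
      using eq that by (auto simp: equiv_def refl_on_def)
    have sy: "(y, x) \<in> \<theta>" if "(x, y) \<in> \<theta>" for x y using eq that by (auto simp: equiv_def sym_def)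
    have tr: "(x, z) \<in> \<theta>" if "(x, y) \<in> \<theta>" "(y, z) \<in> \<theta>" for x y z
      using eq that by (auto simp: equiv_def dest: transD)
    have mu: "(x \<otimes> y, x' \<otimes> y') \<in> \<theta>" and im: "(x \<leadsto> y, x' \<leadsto> y') \<in> \<theta>"
      if "(x, x') \<in> \<theta>" "(y, y') \<in> \<theta>" for x x' y y'
      using \<theta> that by (auto simp: hoop_congruence_def)
    obtain a b where ab: "(a, b) \<in> \<theta>" "a \<noteq> b"
      using ne r sub by (force simp: Id_on_def)
    then have c: "a \<in> carrier A" "b \<in> carrier A" using sub by auto
    \<comment> \<open>Distinct \<open>a\<close> and \<open>b\<close> cannot have both implications
      equal to 1; the other implication is related to \<open>a \<leadsto> a\<close> or
      \<open>b \<leadsto> b\<close>, which is 1.\<close>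
    have "\<exists>u. (u, \<one>) \<in> \<theta> \<and> u \<noteq> \<one>"
    proof (cases "a \<preceq> b")
      case True
      then have "b \<leadsto> a \<noteq> \<one>" using ab c le_antisym by (auto simp: le_iff_imp)
      then show ?thesis using im[OF sy[OF ab(1)] r[of a]] c by (auto simp: imp_refl)
    next
      case False
      then show ?thesis using im[OF ab(1) r[of b]] c by (auto simp: le_iff_imp imp_refl)
    qed
    then obtain u where u: "(u, \<one>) \<in> \<theta>" "u \<noteq> \<one>" by blast
    then have uc: "u \<in> carrier A" using sub by auto
    then obtain n :: nat where n: "u [^] n = e" using pow_e least u by blast
    have "(u [^] n, \<one>) \<in> \<theta>" for n :: nat
      by (induction n) (use r mu[OF _ u(1)] in fastforce)+
    then have e1: "(e, \<one>) \<in> \<theta>" using n by metis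
    \<comment> \<open>Multiplying by \<open>x\<close> relates \<open>x \<otimes> e\<close>, which is
      \<open>e\<close>, to \<open>x\<close>.\<close>
    have ex: "(e, x) \<in> \<theta>" if "x \<in> carrier A" for x
      using mu[OF r[OF that] e1] that least mult_e_ge by simp
    have "(x, y) \<in> \<theta>" if "x \<in> carrier A" "y \<in> carrier A" for x y
      using tr[OF sy[OF ex] ex] that by simp
    then show ?thesis using sub by auto
  qed
  then show ?thesis using congruence_Id congruence_full by (auto simp: simple_hoop_def)
qed

end

section \<open>Simple hoops are irreducible\<close>

lemma simple_imp_irreducible:
  fixes A :: "'a hoop_alg"
  assumes A: "hoop A" and simple: "simple_hoop A"
  shows "irreducible_hoop A"
  unfolding irreducible_hoop_def
proof (intro allI impI)
  fix B C :: "'a hoop_alg" and f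
  assume B: "hoop B" and C: "hoop C" and f: "product_morphism C B f"
    and ne: "hoop_iso A (f_product B f C) \<noteq> {}"
  interpret A: hoop A by fact
  interpret B: hoop B by fact
  interpret C: hoop C by fact
  let ?P = "f_product B f C"
  obtain h where h: "h \<in> hoop_iso A ?P" using ne by auto
  have bij: "bij_betw h (carrier A) (carrier ?P)"
    and hm: "\<And>x y. \<lbrakk>x \<in> carrier A; y \<in> carrier A\<rbrakk> \<Longrightarrow> h (x \<otimes>\<^bsub>A\<^esub> y) = h x \<otimes>\<^bsub>?P\<^esub> h y"
    and hi: "\<And>x y. \<lbrakk>x \<in> carrier A; y \<in> carrier A\<rbrakk> \<Longrightarrow> h (x \<leadsto>\<^bsub>A\<^esub> y) = h x \<leadsto>\<^bsub>?P\<^esub> h y"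
    using h by (auto simp: hoop_iso_def iso_def hom_def)
  have f1: "f \<one>\<^bsub>C\<^esub> = \<one>\<^bsub>B\<^esub>" and fC: "\<And>x. x \<in> carrier C \<Longrightarrow> f x \<in> carrier B"
    using f by (auto simp: product_morphism_def)
  have sm: "snd (p \<otimes>\<^bsub>?P\<^esub> q) = snd p \<otimes>\<^bsub>C\<^esub> snd q"
    and si: "snd (p \<leadsto>\<^bsub>?P\<^esub> q) = snd p \<leadsto>\<^bsub>C\<^esub> snd q" for p q
    by (simp_all add: f_product_def split_beta)
  have surj: "\<exists>a \<in> carrier A. h a = (b, x)"
    if "b \<in> carrier B" "x \<in> carrier C" "hoop_le B b (f x)" for b x
  proof -
    have "(b, x) \<in> carrier ?P" using that by (simp add: f_product_def)
    then have "(b, x) \<in> h ` carrier A" using bij by (simp add: bij_betw_def)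
    then show ?thesis by (metis imageE)
  qed
  define \<theta> where "\<theta> = {(a, b). a \<in> carrier A \<and> b \<in> carrier A \<and> snd (h a) = snd (h b)}"
  have "hoop_congruence A \<theta>"
    unfolding hoop_congruence_def equiv_def
    by (auto simp: \<theta>_def refl_on_def sym_def trans_def hm hi sm si)
  then have "\<theta> = Id_on (carrier A) \<or> \<theta> = carrier A \<times> carrier A"
    using simple by (auto simp: simple_hoop_def)
  then show "trivial_hoop B \<or> trivial_hoop C"
  proof
    assume Id: "\<theta> = Id_on (carrier A)"
    \<comment> \<open>As \<open>f\<close> sends 1 to 1, the fibre over 1 contains a copy of all of
      \<open>B\<close>.\<close>
    have "b = \<one>\<^bsub>B\<^esub>" if b: "b \<in> carrier B" for b
    proof -
      obtain a a' where a: "a \<in> carrier A" "h a = (b, \<one>\<^bsub>C\<^esub>)"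
          "a' \<in> carrier A" "h a' = (\<one>\<^bsub>B\<^esub>, \<one>\<^bsub>C\<^esub>)"
        using surj[of b "\<one>\<^bsub>C\<^esub>"] surj[of "\<one>\<^bsub>B\<^esub>" "\<one>\<^bsub>C\<^esub>"] b f1 B.le_one by auto
      then have "(a, a') \<in> \<theta>" by (simp add: \<theta>_def)
      then have "a = a'" using Id by auto
      then show ?thesis using a by simp
    qed
    then show ?thesis by (auto simp: trivial_hoop_def)
  next
    assume full: "\<theta> = carrier A \<times> carrier A"
    \<comment> \<open>The pair \<open>(f x, x)\<close> shows that the projection reaches every
      element of \<open>C\<close>.\<close>
    have "x = \<one>\<^bsub>C\<^esub>" if x: "x \<in> carrier C" for x
    proof -
      obtain a a' where a: "a \<in> carrier A" "h a = (f x, x)"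
          "a' \<in> carrier A" "h a' = (\<one>\<^bsub>B\<^esub>, \<one>\<^bsub>C\<^esub>)"
        using surj[of "f x" x] surj[of "\<one>\<^bsub>B\<^esub>" "\<one>\<^bsub>C\<^esub>"] x f1 fC B.le_one B.le_refl by auto
      then have "(a, a') \<in> \<theta>" using full by simp
      then show ?thesis using a by (simp add: \<theta>_def)
    qed
    then show ?thesis by (auto simp: trivial_hoop_def)
  qed
qed

theorem theorem16:
  fixes A :: "'a hoop_alg"
  assumes "hoop A" and "finite (carrier A)"
  shows "irreducible_hoop A \<longleftrightarrow> simple_hoop A"
proof
  interpret hoop A by fact
  assume irr: "irreducible_hoop A"
  show "simple_hoop A"
  proof (cases "carrier A = {\<one>\<^bsub>A\<^esub>}")
    \<comment> \<open>A one-element hoop has no suitable \<open>e\<close>; its only congruence is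
      both equality and the total relation.\<close>
    case True
    have "\<theta> = carrier A \<times> carrier A" if "hoop_congruence A \<theta>" for \<theta>
    proof -
      have "equiv (carrier A) \<theta>" using that by (simp add: hoop_congruence_def)
      then show ?thesis unfolding True by (auto simp: equiv_def refl_on_def)
    qed
    then have "{\<theta>. hoop_congruence A \<theta>} = {carrier A \<times> carrier A}"
      using congruence_full by blast
    moreover have "Id_on (carrier A) = carrier A \<times> carrier A" unfolding True by auto
    ultimately show ?thesis by (simp only: simple_hoop_def insert_absorb2)
  next
    case False
    then obtain e where e: "e \<noteq> \<one>\<^bsub>A\<^esub>" "hoop_coatom A e"
      using exists_coatom assms(2) one_closed by blast
    interpret hoop_coatom A e by fact
    have "trivial_hoop Up \<or> trivial_hoop Down"
      using irr hoop_Up hoop_Down product_morphism_glue split_at_iso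
      by (auto simp: irreducible_hoop_def)
    moreover have "\<not> trivial_hoop Up"
      using e le_refl by (auto simp: trivial_hoop_def Up_def)
    ultimately have down: "{x \<in> carrier A. x \<preceq> e} = {e}"
      by (simp add: trivial_hoop_def Down_def)
    \<comment> \<open>The product with \<open>e\<close> lies below \<open>e\<close>, so it is
      \<open>e\<close> once \<open>Down\<close> is trivial.\<close>
    have "e \<preceq> x" if x: "x \<in> carrier A" for x
    proof -
      have "e \<otimes>\<^bsub>A\<^esub> x = e" using down mult_le_left[of e x] x by auto
      then show ?thesis using mult_le_right[of e x] x by simp
    qed
    then show ?thesis using simple_if_least_coatom e by blast
  qed
next
  assume "simple_hoop A"
  then show "irreducible_hoop A" using simple_imp_irreducible assms by blast
qed

end
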